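(* For every integer $n\ge 0$ and every choice of real coefficients $\alpha_R\in\mathbb R$ indexed by the dyadic rectangles $R\in\mathcal D^2$ with $|R|=2^{-n}$, $$\bigg\|\sum_{R\in\mathcal D^2:\,|R|=2^{-n}}\alpha_R h_R\bigg\|_\infty\ \ge\ 2^{-n}\sum_{R\in\mathcal D^2:\,|R|=2^{-n}}|\alpha_R|.$$
   Context: $\mathcal D$ denotes the set of dyadic intervals in $[0,1)$, i.e. intervals $[m2^{-k},(m+1)2^{-k})$ with $k\in\mathbb N_0=\{0,1,2,\dots\}$ and $m\in\{0,1,\dots,2^k-1\}$. For $I\in\mathcal D$, the ($L^\infty$-normalized) Haar function is $h_I=-\mathbf 1_{I_{left}}+\mathbf 1_{I_{right}}$, where $I_{left},I_{right}$ are the left and right (half-open) halves of $I$; so $h_I=0$ outside $I$. $\mathcal D^2$ is the set of dyadic rectangles $R=R_1\times R_2$ with $R_1,R_2\in\mathcal D$, $|R|=|R_1|\,|R_2|$ is the area, and $h_R(x_1,x_2)=h_{R_1}(x_1)h_{R_2}(x_2)$. $\|\cdot\|_\infty$ is the supremum norm on $[0,1)^2$. *)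

theory Defs
  imports "HOL-Analysis.Analysis"
begin

definition dyadic_intervals :: "real set set" where
  "dyadic_intervals = {{real m / 2 ^ k ..< real (m + 1) / 2 ^ k} | m k :: nat. m < 2 ^ k}"

text \<open>The halves are cut at the midpoint. They are meant for nonempty half-open intervals
  \<open>{a..<b}\<close>, where the infimum is \<open>a\<close> and the supremum is \<open>b\<close>; see the lemma below.\<close>

definition left_half :: "real set \<Rightarrow> real set" where
  "left_half I = {Inf I ..< (Inf I + Sup I) / 2}"

definition right_half :: "real set \<Rightarrow> real set" where
  "right_half I = {(Inf I + Sup I) / 2 ..< Sup I}"

definition haar :: "real set \<Rightarrow> real \<Rightarrow> real" where
  "haar I x = - indicator (left_half I) x + indicator (right_half I) x"

definition dyadic_rectangles :: "(real \<times> real) set set" where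
  "dyadic_rectangles = {R1 \<times> R2 | R1 R2. R1 \<in> dyadic_intervals \<and> R2 \<in> dyadic_intervals}"

definition dyadic_rectangles_of_area :: "nat \<Rightarrow> (real \<times> real) set set" where
  "dyadic_rectangles_of_area n = {R \<in> dyadic_rectangles. measure lborel R = 1 / 2 ^ n}"

text \<open>The sides of a rectangle are recovered as its two coordinate projections.\<close>

definition haar_rect :: "(real \<times> real) set \<Rightarrow> real \<times> real \<Rightarrow> real" where
  "haar_rect R x = haar (fst ` R) (fst x) * haar (snd ` R) (snd x)"

text \<open>The pointwise supremum of the absolute value, not an essential supremum. As a supremum in
  the reals it is meaningful for functions that are bounded on the unit square, such as finite
  linear combinations of Haar functions.\<close>

definition sup_norm :: "(real \<times> real \<Rightarrow> real) \<Rightarrow> real" where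
  "sup_norm f = (SUP x \<in> {0..<1} \<times> {0..<1}. \<bar>f x\<bar>)"

lemma halves_atLeastLessThan:
  assumes "a < b"
  shows "left_half {a..<b} = {a..<(a + b) / 2}" and "right_half {a..<b} = {(a + b) / 2..<b}"
  using assms by (simp_all add: left_half_def right_half_def)

lemma haar_rect_Times:
  assumes "R1 \<in> dyadic_intervals" "R2 \<in> dyadic_intervals"
  shows "haar_rect (R1 \<times> R2) (x1, x2) = haar R1 x1 * haar R2 x2"
proof -
  have "R1 \<noteq> {}" "R2 \<noteq> {}"
    using assms by (auto simp: dyadic_intervals_def divide_strict_right_mono)
  then show ?thesis by (simp add: haar_rect_def)
qed

lemma measure_dyadic_rectangle:
  assumes "R1 \<in> dyadic_intervals" "R2 \<in> dyadic_intervals"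
  shows "measure lborel (R1 \<times> R2) = measure lborel R1 * measure lborel R2"
proof -
  have "R1 \<in> sets lborel" "R2 \<in> sets lborel"
    using assms by (auto simp: dyadic_intervals_def)
  then have "emeasure lborel (R1 \<times> R2) = emeasure lborel R1 * emeasure lborel R2"
    by (simp add: lborel.emeasure_pair_measure_Times flip: lborel_prod)
  then show ?thesis by (simp add: measure_def enn2real_mult)
qed

lemma finite_dyadic_rectangles_of_area: "finite (dyadic_rectangles_of_area n)"
proof -
  define J where "J = (\<lambda>(m::nat, k::nat). {real m / 2 ^ k ..< real (m + 1) / 2 ^ k})"
  have len: "measure lborel (J (m, k)) = 1 / 2 ^ k" for m k
    by (simp add: J_def divide_right_mono flip: diff_divide_distrib)
  have mem: "J (m, k) \<in> dyadic_intervals" if "m < 2 ^ k" for m k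
    using that by (auto simp: J_def dyadic_intervals_def)
  define P where "P = {(m, k). k \<le> n \<and> m < (2::nat) ^ n}"
  have "finite P"
    by (rule finite_subset[of _ "{..<2 ^ n} \<times> {..n}"]) (auto simp: P_def)
  have "dyadic_rectangles_of_area n \<subseteq> (\<lambda>(p, q). J p \<times> J q) ` (P \<times> P)"
  proof
    fix R assume "R \<in> dyadic_rectangles_of_area n"
    then obtain m k m' k' where R: "R = J (m, k) \<times> J (m', k')"
      and m: "m < 2 ^ k" "m' < 2 ^ k'" and area: "measure lborel R = 1 / 2 ^ n"
      by (auto simp: dyadic_rectangles_of_area_def dyadic_rectangles_def dyadic_intervals_def J_def)
    have "measure lborel R = 1 / 2 ^ (k + k')"
      using measure_dyadic_rectangle[OF mem mem] m by (simp add: R len power_add)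
    with area have "(2::real) ^ (k + k') = 2 ^ n" by (simp add: field_simps)
    then have "k + k' = n" by (subst (asm) power_inject_exp) auto
    then have "k \<le> n" "k' \<le> n" by auto
    moreover from this have "m < 2 ^ n" "m' < 2 ^ n"
      using m by (meson less_le_trans one_le_numeral power_increasing)+
    ultimately show "R \<in> (\<lambda>(p, q). J p \<times> J q) ` (P \<times> P)"
      by (force simp: R P_def)
  qed
  then show ?thesis
    using \<open>finite P\<close> by (meson finite_SigmaI finite_imageI finite_subset)
qed

end

theory Submission
  imports Defs
begin

text \<open>Identify a point with the binary digits of its coordinates. For each \<open>k \<le> n\<close> a point lies in
  exactly one rectangle of area \<open>2\<^sup>-\<^sup>n\<close> and width \<open>2\<^sup>-\<^sup>k\<close>, and the sign of the Haar function there is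
  given by digit \<open>k + 1\<close> of the first and digit \<open>n - k + 1\<close> of the second coordinate. Let \<open>X\<close> be
  the set of points of the grid of mesh \<open>2\<^sup>-\<^sup>n\<^sup>-\<^sup>1\<close> at which each of the \<open>n + 1\<close> nonvanishing terms
  equals the absolute value of its coefficient (with a fixed sign pattern where a coefficient is 0).
  A rectangle of area \<open>2\<^sup>-\<^sup>n\<close> contains exactly two points of \<open>X\<close>: the next digit of the first
  coordinate is free, and the sign conditions then determine the remaining digits of both
  coordinates one after another. So \<open>X\<close> has \<open>2\<^sup>n\<^sup>+\<^sup>1\<close> points, and averaging the sum over \<open>X\<close> gives
  the bound. (\<open>X\<close> spans the support of the usual Riesz product.)\<close>

text \<open>The last digits of the prefixes \<open>u\<close> and \<open>v\<close> select the halves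
  of the two sides, so equal parities mean Haar sign +1. \<open>G k i j\<close> says whether the
  rectangle with side indices \<open>i\<close>, \<open>j\<close> is to have that sign.\<close>

definition aligned :: "(nat \<Rightarrow> nat \<Rightarrow> nat \<Rightarrow> bool) \<Rightarrow> nat \<Rightarrow> nat \<Rightarrow> nat \<Rightarrow> bool" where
  "aligned G k u v \<longleftrightarrow> (odd u \<longleftrightarrow> odd v) = G k (u div 2) (v div 2)"

text \<open>The points known up to \<open>q + 1\<close> digits of \<open>x\<close> and \<open>n - p + 1\<close> digits of \<open>y\<close>; these are the
  digits that the sign conditions for \<open>k = p, \<dots>, q\<close> involve.\<close>

definition aligned_points :: "nat \<Rightarrow> (nat \<Rightarrow> nat \<Rightarrow> nat \<Rightarrow> bool) \<Rightarrow> nat \<Rightarrow> nat \<Rightarrow> (nat \<times> nat) set" where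
  "aligned_points n G p q = {(x, y). x < 2 ^ Suc q \<and> y < 2 ^ Suc (n - p) \<and>
     (\<forall>k\<in>{p..q}. aligned G k (x div 2 ^ (q - k)) (y div 2 ^ (k - p)))}"

section \<open>Determining binary digits one at a time\<close>

lemma div_2_power_Suc_left: "(x::nat) div 2 ^ Suc d = x div 2 div 2 ^ d"
  by (simp add: div_mult2_eq)

lemma div_2_power_Suc_right: "(x::nat) div 2 ^ Suc d = x div 2 ^ d div 2"
  by (simp add: div_mult2_eq mult.commute[of 2])

text \<open>The conditions up to \<open>q\<close> see only prefixes of \<open>x div 2\<close>, so
  the last digit of \<open>x\<close> enters condition \<open>Suc q\<close> alone.\<close>

lemma aligned_points_Suc_right:
  assumes "p \<le> q"
  shows "(x, y) \<in> aligned_points n G p (Suc q) \<longleftrightarrow>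
    (x div 2, y) \<in> aligned_points n G p q \<and> aligned G (Suc q) x (y div 2 ^ (Suc q - p))"
proof -
  have "{p..Suc q} = insert (Suc q) {p..q}" using assms by auto
  moreover have "x div 2 ^ (Suc q - k) = x div 2 div 2 ^ (q - k)" if "k \<le> q" for k
    using that by (simp add: Suc_diff_le div_mult2_eq)
  ultimately show ?thesis by (auto simp: aligned_points_def)
qed

lemma aligned_points_Suc_left:
  assumes "p < q" "q \<le> n"
  shows "(x, y) \<in> aligned_points n G p q \<longleftrightarrow>
    (x, y div 2) \<in> aligned_points n G (Suc p) q \<and> aligned G p (x div 2 ^ (q - p)) y"
proof -
  have "{p..q} = insert p {Suc p..q}" using assms by auto
  moreover have "y div 2 ^ (k - p) = y div 2 div 2 ^ (k - Suc p)" if "Suc p \<le> k" for k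
    using that div_2_power_Suc_left[of y "k - Suc p"] by (simp add: Suc_diff_Suc)
  \<comment> \<open>Here \<open>p < q\<close> and \<open>q \<le> n\<close> keep the truncated
    subtraction exact, so \<open>y\<close> has just one digit more than
    \<open>y div 2\<close>.\<close>
  moreover have "Suc (n - p) = Suc (Suc (n - Suc p))" using assms by simp
  ultimately show ?thesis by (auto simp: aligned_points_def)
qed

lemma ex1_digit: "\<exists>!x::nat. x div 2 = u \<and> (odd x \<longleftrightarrow> b)"
proof (rule ex1I)
  show "(2 * u + of_bool b) div 2 = u \<and> (odd (2 * u + of_bool b) \<longleftrightarrow> b)" by (cases b) auto
next
  fix x :: nat assume "x div 2 = u \<and> (odd x \<longleftrightarrow> b)"
  then show "x = 2 * u + of_bool b" by (cases b) (auto elim!: oddE evenE)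
qed

text \<open>\<open>G\<close> is evaluated at \<open>x div 2\<close> and \<open>v div 2\<close>, so
  once \<open>u\<close> and \<open>v\<close> are fixed the condition merely prescribes the parity of
  \<open>x\<close>.\<close>

lemma ex1_aligned_left: "\<exists>!x. x div 2 = u \<and> aligned G k x v"
proof -
  have "x div 2 = u \<and> aligned G k x v \<longleftrightarrow> x div 2 = u \<and> (odd x \<longleftrightarrow> (odd v \<longleftrightarrow> G k u (v div 2)))" for x
    by (auto simp: aligned_def)
  then show ?thesis by (simp only: ex1_digit)
qed

lemma ex1_aligned_right: "\<exists>!y. y div 2 = v \<and> aligned G k u y"
proof -
  have "y div 2 = v \<and> aligned G k u y \<longleftrightarrow> y div 2 = v \<and> (odd y \<longleftrightarrow> (odd u \<longleftrightarrow> G k (u div 2) v))" for y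
    by (auto simp: aligned_def)
  then show ?thesis by (simp only: ex1_digit)
qed

lemma aligned_left_eqI:
  "x div 2 = x' div 2 \<Longrightarrow> aligned G k x v \<Longrightarrow> aligned G k x' v \<Longrightarrow> x = x'"
  using ex1_aligned_left by blast

lemma aligned_right_eqI:
  "y div 2 = y' div 2 \<Longrightarrow> aligned G k u y \<Longrightarrow> aligned G k u y' \<Longrightarrow> y = y'"
  using ex1_aligned_right by blast

lemma bij_betw_aligned_points_right:
  assumes "p \<le> q"
  shows "bij_betw (\<lambda>(x, y). (x div 2, y)) (aligned_points n G p (Suc q)) (aligned_points n G p q)"
proof (rule bij_betwI', goal_cases)
  case (1 s t)
  then show ?case
    by (cases s; cases t) (auto simp: aligned_points_Suc_right[OF assms] dest: aligned_left_eqI)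
next
  case (2 s)
  then show ?case by (cases s) (auto simp: aligned_points_Suc_right[OF assms])
next
  case (3 s)
  obtain u y where s: "s = (u, y)" by (cases s)
  obtain x where "x div 2 = u" "aligned G (Suc q) x (y div 2 ^ (Suc q - p))"
    using ex1_aligned_left[of u G "Suc q" "y div 2 ^ (Suc q - p)"] by blast
  with 3 show ?case
    by (intro bexI[of _ "(x, y)"]) (simp_all add: aligned_points_Suc_right[OF assms] s)
qed

lemma bij_betw_aligned_points_left:
  assumes "p < q" "q \<le> n"
  shows "bij_betw (\<lambda>(x, y). (x, y div 2)) (aligned_points n G p q) (aligned_points n G (Suc p) q)"
proof (rule bij_betwI', goal_cases)
  case (1 s t)
  then show ?case
    by (cases s; cases t) (auto simp: aligned_points_Suc_left[OF assms] dest: aligned_right_eqI)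
next
  case (2 s)
  then show ?case by (cases s) (auto simp: aligned_points_Suc_left[OF assms])
next
  case (3 s)
  obtain x v where s: "s = (x, v)" by (cases s)
  obtain y where "y div 2 = v" "aligned G p (x div 2 ^ (q - p)) y"
    using ex1_aligned_right[of v G p "x div 2 ^ (q - p)"] by blast
  with 3 show ?case
    by (intro bexI[of _ "(x, y)"]) (simp_all add: aligned_points_Suc_left[OF assms] s)
qed

section \<open>Sums over aligned points\<close>

lemma sum_aligned_points_right:
  fixes F :: "nat \<Rightarrow> nat \<Rightarrow> real"
  assumes "p \<le> q"
  shows "(\<Sum>(x, y)\<in>aligned_points n G p (q + d). F (x div 2 ^ d) y) =
    (\<Sum>(x, y)\<in>aligned_points n G p q. F x y)"
proof (induction d)
  case (Suc d)
  have "(\<Sum>(x, y)\<in>aligned_points n G p (q + Suc d). F (x div 2 ^ Suc d) y) =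
      (\<Sum>(x, y)\<in>aligned_points n G p (q + d). F (x div 2 ^ d) y)"
    using sum.reindex_bij_betw[OF bij_betw_aligned_points_right[of p "q + d" n G],
        of "\<lambda>(x, y). F (x div 2 ^ d) y"] assms
    by (simp add: case_prod_unfold div_2_power_Suc_left del: power_Suc)
  with Suc show ?case by simp
qed simp

text \<open>Each deletion of the last digit of \<open>y\<close> is a bijection that removes the
  lowest condition; the summand ignores the \<open>d\<close> deleted digits.\<close>

lemma sum_aligned_points_left:
  fixes F :: "nat \<Rightarrow> nat \<Rightarrow> real"
  assumes "q \<le> n" "d \<le> q"
  shows "(\<Sum>(x, y)\<in>aligned_points n G (q - d) q. F x (y div 2 ^ d)) =
    (\<Sum>(x, y)\<in>aligned_points n G q q. F x y)"
  using assms(2)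
proof (induction d)
  case (Suc d)
  have "(\<Sum>(x, y)\<in>aligned_points n G (q - Suc d) q. F x (y div 2 ^ Suc d)) =
      (\<Sum>(x, y)\<in>aligned_points n G (q - d) q. F x (y div 2 ^ d))"
    using sum.reindex_bij_betw[OF bij_betw_aligned_points_left[of "q - Suc d" q n G],
        of "\<lambda>(x, y). F x (y div 2 ^ d)"] assms(1) Suc.prems
    by (simp add: case_prod_unfold div_2_power_Suc_left Suc_diff_Suc del: power_Suc)
  with Suc show ?case by simp
qed simp

lemma sum_div_2: "(\<Sum>u<2 * m. f (u div 2)) = 2 * (\<Sum>i<m::nat. f i :: real)"
  by (induction m) auto

text \<open>Only one condition is left. It determines the last digit of \<open>v\<close>, while that
  of \<open>u\<close> stays free and yields the factor 2.\<close>

lemma sum_aligned_points_same: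
  fixes F :: "nat \<Rightarrow> nat \<Rightarrow> real"
  shows "(\<Sum>(u, v)\<in>aligned_points n G k k. F (u div 2) (v div 2)) =
    2 * (\<Sum>i<2 ^ k. \<Sum>j<2 ^ (n - k). F i j)"
proof -
  have mem: "(u, v) \<in> aligned_points n G k k \<longleftrightarrow>
      u < 2 * 2 ^ k \<and> v div 2 < 2 ^ (n - k) \<and> aligned G k u v" for u v
    by (auto simp: aligned_points_def)
  have "bij_betw (\<lambda>(u, v). (u, v div 2)) (aligned_points n G k k)
      ({..<2 * 2 ^ k} \<times> {..<2 ^ (n - k)})"
  proof (rule bij_betwI', goal_cases)
    case (1 s t)
    then show ?case by (cases s; cases t) (auto simp: mem dest: aligned_right_eqI)
  next
    case (2 s)
    then show ?case by (cases s) (auto simp: mem)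
  next
    case (3 s)
    obtain u j where s: "s = (u, j)" by (cases s)
    obtain v where "v div 2 = j" "aligned G k u v"
      using ex1_aligned_right[of j G k u] by blast
    with 3 show ?case by (intro bexI[of _ "(u, v)"]) (simp_all add: mem s)
  qed
  from sum.reindex_bij_betw[OF this, of "\<lambda>(u, j). F (u div 2) j"]
  have "(\<Sum>(u, v)\<in>aligned_points n G k k. F (u div 2) (v div 2)) =
      (\<Sum>u<2 * 2 ^ k. \<Sum>j<2 ^ (n - k). F (u div 2) j)"
    by (simp add: case_prod_unfold sum.cartesian_product)
  also have "\<dots> = 2 * (\<Sum>i<2 ^ k. \<Sum>j<2 ^ (n - k). F i j)"
    by (rule sum_div_2)
  finally show ?thesis .
qed

text \<open>This is the count of two points per rectangle, in weighted form and for any sign pattern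
  \<open>G\<close>. First the conditions above \<open>k\<close> go, with the last
  \<open>n - k\<close> digits of \<open>x\<close>, then those below \<open>k\<close>, with the last
  \<open>k\<close> digits of \<open>y\<close>.\<close>

lemma sum_aligned_points:
  fixes F :: "nat \<Rightarrow> nat \<Rightarrow> real"
  assumes "k \<le> n"
  shows "(\<Sum>(x, y)\<in>aligned_points n G 0 n. F (x div 2 ^ Suc (n - k)) (y div 2 ^ Suc k)) =
    2 * (\<Sum>i<2 ^ k. \<Sum>j<2 ^ (n - k). F i j)"
proof -
  show ?thesis
    using sum_aligned_points_right[of 0 k "\<lambda>x y. F (x div 2) (y div 2 ^ k div 2)" "n - k" n G]
      sum_aligned_points_left[of k n k "\<lambda>x y. F (x div 2) (y div 2)" G] assms
      sum_aligned_points_same[where F = F and n = n and G = G and k = k]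
    by (simp add: div_2_power_Suc_right del: power_Suc)
qed

section \<open>Dyadic intervals and Haar functions on the grid\<close>

definition dyadic_interval :: "nat \<Rightarrow> nat \<Rightarrow> real set" where
  "dyadic_interval k i = {real i / 2 ^ k ..< real (i + 1) / 2 ^ k}"

text \<open>Dropping the last \<open>d\<close> binary digits of \<open>x\<close> leaves the index of
  its level-\<open>k\<close> interval.\<close>

lemma grid_mem_dyadic_interval:
  "real x / 2 ^ (k + d) \<in> dyadic_interval k i \<longleftrightarrow> x div 2 ^ d = i"
proof -
  have "real x / 2 ^ (k + d) \<in> dyadic_interval k i \<longleftrightarrow>
      real (i * 2 ^ d) \<le> real x \<and> real x < real ((i + 1) * 2 ^ d)"
    by (simp add: dyadic_interval_def power_add field_simps)
  also have "\<dots> \<longleftrightarrow> i * 2 ^ d \<le> x \<and> x < (i + 1) * 2 ^ d"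
    by (simp only: of_nat_le_iff of_nat_less_iff)
  also have "\<dots> \<longleftrightarrow> x div 2 ^ d = i"
    by (metis Suc_eq_plus1 div_nat_eqI div_times_less_eq_dividend dividend_less_div_times
      mult.commute mult_Suc zero_less_numeral zero_less_power)
  finally show ?thesis .
qed

text \<open>Halving appends a binary digit to the index: 0 on the left, 1 on the right.\<close>

lemma halves_dyadic_interval:
  "left_half (dyadic_interval k i) = dyadic_interval (Suc k) (2 * i)"
  "right_half (dyadic_interval k i) = dyadic_interval (Suc k) (2 * i + 1)"
proof -
  have less: "real i / 2 ^ k < real (i + 1) / 2 ^ k"
    by (simp add: divide_strict_right_mono)
  have "real i / 2 ^ k = real (2 * i) / 2 ^ Suc k"
    and "(real i / 2 ^ k + real (i + 1) / 2 ^ k) / 2 = real (2 * i + 1) / 2 ^ Suc k"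
    and "real (i + 1) / 2 ^ k = real (2 * i + 1 + 1) / 2 ^ Suc k"
    by (simp_all add: field_simps)
  then show "left_half (dyadic_interval k i) = dyadic_interval (Suc k) (2 * i)"
    and "right_half (dyadic_interval k i) = dyadic_interval (Suc k) (2 * i + 1)"
    unfolding dyadic_interval_def halves_atLeastLessThan[OF less] by (simp_all only:)
qed

lemma haar_dyadic_interval_grid:
  "haar (dyadic_interval k i) (real x / 2 ^ (Suc k + d)) =
    (if x div 2 ^ Suc d = i then if odd (x div 2 ^ d) then 1 else - 1 else 0)"
  unfolding haar_def halves_dyadic_interval indicator_def grid_mem_dyadic_interval
    div_2_power_Suc_right by auto

lemma haar_abs_le_1: "\<bar>haar I x\<bar> \<le> 1"
  by (auto simp: haar_def indicator_def)

lemma dyadic_interval_mem: "i < 2 ^ k \<Longrightarrow> dyadic_interval k i \<in> dyadic_intervals"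
  by (auto simp: dyadic_intervals_def dyadic_interval_def)

lemma measure_dyadic_interval: "measure lborel (dyadic_interval k i) = 1 / 2 ^ k"
  by (simp add: dyadic_interval_def divide_right_mono flip: diff_divide_distrib)

lemma dyadic_interval_nonempty: "dyadic_interval k i \<noteq> {}"
  by (simp add: dyadic_interval_def divide_strict_right_mono)

lemma dyadic_interval_eq_iff: "dyadic_interval k i = dyadic_interval l j \<longleftrightarrow> k = l \<and> i = j"
proof
  assume eq: "dyadic_interval k i = dyadic_interval l j"
  then have "1 / 2 ^ k = (1 / 2 ^ l :: real)" by (metis measure_dyadic_interval)
  then have "k = l" by simp
  moreover have "Inf (dyadic_interval k i) = Inf (dyadic_interval l j)" using eq by simp
  ultimately show "k = l \<and> i = j"
    by (simp add: dyadic_interval_def divide_strict_right_mono)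
qed simp

section \<open>Rectangles of fixed area and the value of their Haar sum\<close>

lemma sum_dyadic_rectangles_of_area:
  fixes H :: "(real \<times> real) set \<Rightarrow> real"
  shows "(\<Sum>R\<in>dyadic_rectangles_of_area n. H R) =
    (\<Sum>k\<le>n. \<Sum>i<2 ^ k. \<Sum>j<2 ^ (n - k). H (dyadic_interval k i \<times> dyadic_interval (n - k) j))"
proof -
  define S where "S = (SIGMA k:{..n}. {..<2 ^ k :: nat} \<times> {..<2 ^ (n - k) :: nat})"
  define f where "f = (\<lambda>(k, i, j). dyadic_interval k i \<times> dyadic_interval (n - k) j)"
  have area: "measure lborel (dyadic_interval k i \<times> dyadic_interval l j) = 1 / 2 ^ (k + l)"
    if "i < 2 ^ k" "j < 2 ^ l" for k l i j
    using that
    by (simp add: measure_dyadic_rectangle dyadic_interval_mem measure_dyadic_interval power_add)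
  have "inj_on f S"
    by (auto simp: inj_on_def f_def times_eq_iff dyadic_interval_nonempty dyadic_interval_eq_iff)
  moreover have "f ` S = dyadic_rectangles_of_area n"
  proof (intro equalityI subsetI)
    fix R assume "R \<in> f ` S"
    then show "R \<in> dyadic_rectangles_of_area n"
      by (auto simp: S_def f_def dyadic_rectangles_of_area_def dyadic_rectangles_def area
          intro: dyadic_interval_mem)
  next
    fix R assume "R \<in> dyadic_rectangles_of_area n"
    then obtain k i l j where R: "R = dyadic_interval k i \<times> dyadic_interval l j"
      and lt: "i < 2 ^ k" "j < 2 ^ l" and "measure lborel R = 1 / 2 ^ n"
      by (auto simp: dyadic_rectangles_of_area_def dyadic_rectangles_def dyadic_intervals_def
          dyadic_interval_def)
    then have "1 / 2 ^ (k + l) = (1 / 2 ^ n :: real)" by (metis area)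
    \<comment> \<open>The area fixes the sum of the two levels, so \<open>k\<close> alone determines
      the shape.\<close>
    then have "k + l = n" using power_inject_exp[of "2::real" "k + l" n] by simp
    then show "R \<in> f ` S"
      using lt by (intro image_eqI[of _ _ "(k, i, j)"]) (auto simp: R S_def f_def)
  qed
  ultimately have "(\<Sum>R\<in>dyadic_rectangles_of_area n. H R) = (\<Sum>s\<in>S. H (f s))"
    by (metis sum.reindex_cong)
  also have "\<dots> = (\<Sum>k\<le>n. \<Sum>i<2 ^ k. \<Sum>j<2 ^ (n - k).
      H (dyadic_interval k i \<times> dyadic_interval (n - k) j))"
    by (simp add: S_def f_def sum.Sigma sum.cartesian_product case_prod_unfold)
  finally show ?thesis .
qed

text \<open>The rectangles of one shape partition the square, so for each \<open>k\<close> just the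
  one containing the point contributes.\<close>

lemma haar_sum_grid:
  assumes "x < 2 ^ Suc n" "y < 2 ^ Suc n"
  shows "(\<Sum>R\<in>dyadic_rectangles_of_area n. \<alpha> R * haar_rect R (real x / 2 ^ Suc n, real y / 2 ^ Suc n)) =
    (\<Sum>k\<le>n. \<alpha> (dyadic_interval k (x div 2 ^ Suc (n - k)) \<times> dyadic_interval (n - k) (y div 2 ^ Suc k)) *
      (if odd (x div 2 ^ (n - k)) \<longleftrightarrow> odd (y div 2 ^ k) then 1 else - 1))"
  (is "?lhs = _")
proof -
  have "(\<Sum>i<2 ^ k. \<Sum>j<2 ^ (n - k). \<alpha> (dyadic_interval k i \<times> dyadic_interval (n - k) j) *
        haar_rect (dyadic_interval k i \<times> dyadic_interval (n - k) j)
          (real x / 2 ^ Suc n, real y / 2 ^ Suc n)) =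
      \<alpha> (dyadic_interval k (x div 2 ^ Suc (n - k)) \<times> dyadic_interval (n - k) (y div 2 ^ Suc k)) *
        (if odd (x div 2 ^ (n - k)) \<longleftrightarrow> odd (y div 2 ^ k) then 1 else - 1)"
    (is "?l = ?a * ?s") if "k \<le> n" for k
  proof -
    let ?i = "x div 2 ^ Suc (n - k)" and ?j = "y div 2 ^ Suc k"
    \<comment> \<open>Beyond the digit that selects a half, \<open>n - k\<close> digits remain for
      the side of level \<open>k\<close> and \<open>k\<close> digits for the side of level
      \<open>n - k\<close>.\<close>
    have n: "Suc k + (n - k) = Suc n" "Suc (n - k) + k = Suc n" using that by auto
    have bounds: "?i < 2 ^ k" "?j < 2 ^ (n - k)"
      using assms that by (auto simp: less_mult_imp_div_less simp flip: power_Suc power_add)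
    have haar1: "haar (dyadic_interval k i) (real x / 2 ^ Suc n) =
        (if ?i = i then if odd (x div 2 ^ (n - k)) then 1 else - 1 else 0)" for i
      using haar_dyadic_interval_grid[of k i x "n - k"] by (simp only: n)
    have haar2: "haar (dyadic_interval (n - k) j) (real y / 2 ^ Suc n) =
        (if ?j = j then if odd (y div 2 ^ k) then 1 else - 1 else 0)" for j
      using haar_dyadic_interval_grid[of "n - k" j y k] by (simp only: n)
    have "?l = (\<Sum>i<2 ^ k. \<Sum>j<2 ^ (n - k). if ?i = i then if ?j = j then ?a * ?s else 0 else 0)"
    proof (intro sum.cong refl)
      fix i j :: nat assume "i \<in> {..<2 ^ k}" "j \<in> {..<2 ^ (n - k)}"
      then have "haar_rect (dyadic_interval k i \<times> dyadic_interval (n - k) j)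
          (real x / 2 ^ Suc n, real y / 2 ^ Suc n) =
          (if ?i = i then if ?j = j then ?s else 0 else 0)"
        by (simp add: haar_rect_Times dyadic_interval_mem haar1 haar2 del: power_Suc)
      then show "\<alpha> (dyadic_interval k i \<times> dyadic_interval (n - k) j) *
          haar_rect (dyadic_interval k i \<times> dyadic_interval (n - k) j)
            (real x / 2 ^ Suc n, real y / 2 ^ Suc n) =
          (if ?i = i then if ?j = j then ?a * ?s else 0 else 0)"
        by (simp only: split: if_split) simp
    qed
    also have "\<dots> = (\<Sum>i<2 ^ k. if ?i = i then ?a * ?s else 0)"
    proof (intro sum.cong refl)
      fix i :: nat
      show "(\<Sum>j<2 ^ (n - k). if ?i = i then if ?j = j then ?a * ?s else 0 else 0) =
          (if ?i = i then ?a * ?s else 0)"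
        using bounds(2) by (cases "?i = i") (simp_all del: power_Suc)
    qed
    also have "\<dots> = ?a * ?s"
      using bounds(1) by (simp del: power_Suc)
    finally show ?thesis .
  qed
  then show ?thesis 
    unfolding sum_dyadic_rectangles_of_area by (intro sum.cong refl) (simp only: atMost_iff)
qed

section \<open>The supremum bound and the averaging argument\<close>

lemma abs_haar_sum_le_sup_norm:
  assumes "finite A" "p \<in> {0..<1} \<times> {0..<1}"
  shows "\<bar>\<Sum>R\<in>A. \<alpha> R * haar_rect R p\<bar> \<le> sup_norm (\<lambda>x. \<Sum>R\<in>A. \<alpha> R * haar_rect R x)"
proof -
  have "\<bar>\<Sum>R\<in>A. \<alpha> R * haar_rect R x\<bar> \<le> (\<Sum>R\<in>A. \<bar>\<alpha> R\<bar>)" for x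
  proof (rule order_trans[OF sum_abs sum_mono])
    fix R
    have "\<bar>haar_rect R x\<bar> \<le> 1"
      by (simp add: haar_rect_def abs_mult haar_abs_le_1 mult_le_one)
    then show "\<bar>\<alpha> R * haar_rect R x\<bar> \<le> \<bar>\<alpha> R\<bar>"
      by (simp add: abs_mult mult_left_le)
  qed
  \<comment> \<open>A real \<open>SUP\<close> is sure to dominate its members only once boundedness
    is known; the sum of the \<open>\<bar>\<alpha> R\<bar>\<close> provides it.\<close>
  then have "bdd_above ((\<lambda>x. \<bar>\<Sum>R\<in>A. \<alpha> R * haar_rect R x\<bar>) ` ({0..<1} \<times> {0..<1}))"
    by (intro bdd_aboveI2)
  then show ?thesis
    unfolding sup_norm_def using assms(2) by (intro cSUP_upper)
qed

theorem theorem4: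
  fixes n :: nat and \<alpha> :: "(real \<times> real) set \<Rightarrow> real"
  shows "sup_norm (\<lambda>x. \<Sum>R \<in> dyadic_rectangles_of_area n. \<alpha> R * haar_rect R x)
           \<ge> 1 / 2 ^ n * (\<Sum>R \<in> dyadic_rectangles_of_area n. \<bar>\<alpha> R\<bar>)"
proof -
  define f where "f = (\<lambda>x. \<Sum>R \<in> dyadic_rectangles_of_area n. \<alpha> R * haar_rect R x)"
  define c where "c k i j = \<alpha> (dyadic_interval k i \<times> dyadic_interval (n - k) j)" for k i j
  \<comment> \<open>Zero coefficients count as positive; their terms vanish under either sign, so
    every term still equals an absolute value.\<close>
  define X where "X = aligned_points n (\<lambda>k i j. c k i j \<ge> 0) 0 n"
  have f: "f (real x / 2 ^ Suc n, real y / 2 ^ Suc n) =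
      (\<Sum>k\<le>n. \<bar>c k (x div 2 ^ Suc (n - k)) (y div 2 ^ Suc k)\<bar>)" if "(x, y) \<in> X" for x y
  proof -
    have less: "x < 2 ^ Suc n" "y < 2 ^ Suc n"
      using that by (auto simp: X_def aligned_points_def)
    have "(odd (x div 2 ^ (n - k)) \<longleftrightarrow> odd (y div 2 ^ k)) \<longleftrightarrow>
        c k (x div 2 ^ Suc (n - k)) (y div 2 ^ Suc k) \<ge> 0" if "k \<le> n" for k
      using \<open>(x, y) \<in> X\<close> that
      by (simp add: X_def aligned_points_def aligned_def div_2_power_Suc_right del: power_Suc)
    then show ?thesis
      unfolding f_def haar_sum_grid[OF less]
      by (intro sum.cong refl) (simp add: c_def abs_if del: power_Suc)
  qed
  \<comment> \<open>The factor 2 is the number of points of \<open>X\<close> in each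
    rectangle.\<close>
  have "2 * (\<Sum>R \<in> dyadic_rectangles_of_area n. \<bar>\<alpha> R\<bar>) =
      (\<Sum>k\<le>n. 2 * (\<Sum>i<2 ^ k. \<Sum>j<2 ^ (n - k). \<bar>c k i j\<bar>))"
    by (simp add: sum_dyadic_rectangles_of_area c_def sum_distrib_left)
  also have "\<dots> = (\<Sum>k\<le>n. \<Sum>(x, y)\<in>X. \<bar>c k (x div 2 ^ Suc (n - k)) (y div 2 ^ Suc k)\<bar>)"
    unfolding X_def by (intro sum.cong refl sum_aligned_points[symmetric]) simp
  also have "\<dots> = (\<Sum>(x, y)\<in>X. f (real x / 2 ^ Suc n, real y / 2 ^ Suc n))"
    by (subst sum.swap) (auto intro!: sum.cong simp: f simp del: power_Suc)
  also have "\<dots> \<le> (\<Sum>(x, y)\<in>X. sup_norm f)"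
  proof (intro sum_mono, clarify)
    fix x y assume "(x, y) \<in> X"
    then have "x < 2 ^ Suc n" "y < 2 ^ Suc n"
      by (auto simp: X_def aligned_points_def)
    then have "real x < 2 ^ Suc n" "real y < 2 ^ Suc n"
      using of_nat_less_iff[of x "2 ^ Suc n", where 'a = real]
        of_nat_less_iff[of y "2 ^ Suc n", where 'a = real]
      by (simp_all only: of_nat_power of_nat_numeral)
    then have "(real x / 2 ^ Suc n, real y / 2 ^ Suc n) \<in> {0..<1} \<times> {0..<1}"
      by simp
    then show "f (real x / 2 ^ Suc n, real y / 2 ^ Suc n) \<le> sup_norm f"
      using abs_haar_sum_le_sup_norm[OF finite_dyadic_rectangles_of_area] abs_le_D1
      unfolding f_def by blast
  qed
  \<comment> \<open>The case \<open>k = 0\<close> with a constant summand counts \<open>X\<close>: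
    there are \<open>2 ^ n\<close> rectangles of full width, with two points each.\<close>
  also have "\<dots> = 2 * 2 ^ n * sup_norm f"
    using sum_aligned_points[of 0 n "\<lambda>_ _. sup_norm f"] by (simp add: X_def)
  finally show ?thesis
    unfolding f_def by (simp add: field_simps)
qed

end
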